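(* Let $d\in\{1,2\}$, let $\Lambda=\omega\cdot\mathbb{Z}^{\nu}\subseteq\mathbb{R}$ with $b=\nu-1$ if $d=1$, and $\Lambda=\omega^{(1)}\cdot\mathbb{Z}^{\nu_1}\times\omega^{(2)}\cdot\mathbb{Z}^{\nu_2}\subseteq\mathbb{R}^2$ with $b=(\nu_1-1)+(\nu_2-1)$ if $d=2$, where the frequency vectors are non-resonant with all components in $(1/2,1]$. If $s<\frac b2$, then for every $T>0$ the first Picard iterate of the cubic nonlinear Schrödinger equation is unbounded in $\mathcal{H}^s_\Lambda$: there is no constant $K$ such that $$\sup_{t\in[0,T]}\Big\|\int_0^te^{i(t-\tau)\Delta}\big(|e^{i\tau\Delta}f|^2e^{i\tau\Delta}f\big)d\tau\Big\|_{\mathcal{H}^s_\Lambda}\le K\|f\|^3_{\mathcal{H}^s_\Lambda}$$ for all trigonometric polynomials $f$ with frequencies in $\Lambda$.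
   Context: A vector in $\mathbb{R}^{\nu}_{>0}$ is non-resonant if its components are linearly independent over $\mathbb{Q}$. For $d=1$ and $n\in\mathbb{Z}^\nu$, $\langle n\rangle_\omega=n\cdot\omega$; for $d=2$ and $n=(n_1,n_2)\in\mathbb{Z}^{\nu_1}\times\mathbb{Z}^{\nu_2}$, $\langle n\rangle_\omega=(n_1\cdot\omega^{(1)},n_2\cdot\omega^{(2)})\in\mathbb{R}^2$. For a trigonometric polynomial $f=\sum_na_ne^{i\langle n\rangle_\omega\cdot x}$ (finitely many $a_n\ne0$), $\|f\|^2_{\mathcal{H}^s_\Lambda}=\sum_n(1+|n|)^{2s}|a_n|^2$ and $e^{it\Delta}f=\sum_na_ne^{i(\langle n\rangle_\omega\cdot x-t|\langle n\rangle_\omega|^2)}$. *)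

theory Defs
  imports "HOL-Analysis.Analysis"
begin

definition non_resonant :: "real ^ 'n \<Rightarrow> bool" where
  "non_resonant \<omega> \<longleftrightarrow> (\<forall>i. 0 < \<omega> $ i) \<and>
     (\<forall>q :: 'n \<Rightarrow> rat. (\<Sum>i\<in>UNIV. of_rat (q i) * \<omega> $ i) = 0 \<longrightarrow> (\<forall>i. q i = 0))"

definition int_vec :: "int ^ 'n \<Rightarrow> real ^ 'n" where
  "int_vec n = (\<chi> i. of_int (n $ i))"

definition freq1 :: "real ^ 'n \<Rightarrow> int ^ 'n \<Rightarrow> real" where
  "freq1 \<omega> n = int_vec n \<bullet> \<omega>"

definition freq2 ::
  "real ^ 'n1 \<Rightarrow> real ^ 'n2 \<Rightarrow> (int ^ 'n1) \<times> (int ^ 'n2) \<Rightarrow> real \<times> real" where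
  "freq2 \<omega>1 \<omega>2 n = (int_vec (fst n) \<bullet> \<omega>1, int_vec (snd n) \<bullet> \<omega>2)"

text \<open>The size of an index is its Euclidean norm; for a pair of indices it is
  the Euclidean norm of the concatenated vector.\<close>

definition size1 :: "int ^ 'n \<Rightarrow> real" where
  "size1 n = norm (int_vec n)"

definition size2 :: "(int ^ 'n1) \<times> (int ^ 'n2) \<Rightarrow> real" where
  "size2 n = norm (int_vec (fst n), int_vec (snd n))"

text \<open>The remaining notions treat both dimensions at once. The set \<open>\<Lambda>\<close> of
  admissible frequencies is given by its parametrization \<open>\<phi>\<close> (either \<open>freq1 \<omega>\<close> or
  \<open>freq2 \<omega>1 \<omega>2\<close>, so \<open>\<Lambda> = range \<phi>\<close>), and \<open>sz\<close> is the corresponding size of indices.\<close>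

definition is_expansion ::
  "('k \<Rightarrow> 'e::euclidean_space) \<Rightarrow> ('k \<Rightarrow> complex) \<Rightarrow> ('e \<Rightarrow> complex) \<Rightarrow> bool" where
  "is_expansion \<phi> a f \<longleftrightarrow> finite {n. a n \<noteq> 0} \<and>
     f = (\<lambda>x. \<Sum>n | a n \<noteq> 0. a n * cis (\<phi> n \<bullet> x))"

definition trig_polys :: "('k \<Rightarrow> 'e::euclidean_space) \<Rightarrow> ('e \<Rightarrow> complex) set" where
  "trig_polys \<phi> = {f. \<exists>a. is_expansion \<phi> a f}"

text \<open>Under non-resonance \<open>\<phi>\<close> is injective, so the expansion of a trigonometric
  polynomial is unique. Outside \<open>trig_polys \<phi>\<close> the value of \<open>coeffs\<close> is unspecified,
  and so are the two notions below that depend on it.\<close>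

definition coeffs :: "('k \<Rightarrow> 'e::euclidean_space) \<Rightarrow> ('e \<Rightarrow> complex) \<Rightarrow> 'k \<Rightarrow> complex" where
  "coeffs \<phi> f = (THE a. is_expansion \<phi> a f)"

definition sobolev_norm ::
  "('k \<Rightarrow> 'e::euclidean_space) \<Rightarrow> ('k \<Rightarrow> real) \<Rightarrow> real \<Rightarrow> ('e \<Rightarrow> complex) \<Rightarrow> real" where
  "sobolev_norm \<phi> sz s f =
     sqrt (\<Sum>n | coeffs \<phi> f n \<noteq> 0. (1 + sz n) powr (2 * s) * (cmod (coeffs \<phi> f n))\<^sup>2)"

definition schroedinger ::
  "('k \<Rightarrow> 'e::euclidean_space) \<Rightarrow> real \<Rightarrow> ('e \<Rightarrow> complex) \<Rightarrow> 'e \<Rightarrow> complex" where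
  "schroedinger \<phi> t f =
     (\<lambda>x. \<Sum>n | coeffs \<phi> f n \<noteq> 0. coeffs \<phi> f n * cis (\<phi> n \<bullet> x - t * (norm (\<phi> n))\<^sup>2))"

definition cubic :: "('e \<Rightarrow> complex) \<Rightarrow> 'e \<Rightarrow> complex" where
  "cubic u = (\<lambda>x. of_real ((cmod (u x))\<^sup>2) * u x)"

text \<open>The time integral is taken pointwise in \<open>x\<close>; for a trigonometric polynomial \<open>f\<close>
  the result is again a trigonometric polynomial, with coefficients integrated in time.\<close>

definition picard ::
  "('k \<Rightarrow> 'e::euclidean_space) \<Rightarrow> real \<Rightarrow> ('e \<Rightarrow> complex) \<Rightarrow> 'e \<Rightarrow> complex" where
  "picard \<phi> t f = (\<lambda>x. integral {0..t}
     (\<lambda>\<tau>. schroedinger \<phi> (t - \<tau>) (cubic (schroedinger \<phi> \<tau> f)) x))"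

end

theory Submission
  imports Defs
begin

text \<open>Take \<open>f = \<Sum>n\<in>v + S. cis (\<phi> n \<bullet> x)\<close>, where \<open>S\<close> consists of the indices in a box of side \<open>N\<close>
  whose frequency is bounded, so that \<open>card S\<close> is of order \<open>N ^ b\<close>, and \<open>v\<close> moves \<open>S\<close> to where all
  indices have size of order \<open>N\<close>. The phase of an interaction \<open>n1 - n2 + n3\<close> is
  \<open>2 (\<phi> n1 - \<phi> n2) \<bullet> (\<phi> n3 - \<phi> n2)\<close>; it does not see the translation by \<open>v\<close>, hence is bounded,
  and for a small fixed time \<open>t\<close> there is no cancellation. If \<open>S0 - S0 + S0 \<subseteq> S\<close>, each coefficient
  of the Picard iterate at \<open>v + m\<close> with \<open>m \<in> S0\<close> is at least \<open>t / 2 * (card S0)\<^sup>2\<close>. The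
  squared ratio of the iterate to the cube of \<open>f\<close> is therefore at least of order
  \<open>N powr (2 * b - 4 * s)\<close>.\<close>

section \<open>Independence of characters and uniqueness of coefficients\<close>

text \<open>Induction on \<open>F\<close>: shifting the argument of the relation by \<open>y\<close>
  and subtracting \<open>cis (\<phi> m \<bullet> y)\<close> times the relation removes the character
  at \<open>m\<close>. The coefficient at \<open>n\<close> is only multiplied by
  \<open>cis (\<phi> n \<bullet> y) - cis (\<phi> m \<bullet> y)\<close>.\<close>

lemma characters_independent:
  fixes \<phi> :: "'k \<Rightarrow> 'e::euclidean_space"
  assumes "inj \<phi>" "finite F" "\<And>x. (\<Sum>n\<in>F. a n * cis (\<phi> n \<bullet> x)) = 0" "n \<in> F"
  shows "a n = 0"
  using assms(2-)
proof (induction F arbitrary: a n rule: finite_induct)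
  case empty
  then show ?case by simp
next
  case (insert m F)
  have others: "a k = 0" if "k \<in> F" for k
  proof -
    \<comment> \<open>The shift makes the phases at \<open>k\<close> and \<open>m\<close> differ by
      \<open>pi\<close>, so the factor at \<open>k\<close> does not vanish.\<close>
    define y where "y = (pi / (norm (\<phi> k - \<phi> m))\<^sup>2) *\<^sub>R (\<phi> k - \<phi> m)"
    have "\<phi> k - \<phi> m \<noteq> 0"
      using that insert.hyps(2) \<open>inj \<phi>\<close> by (auto dest: injD)
    then have "(\<phi> k - \<phi> m) \<bullet> y = pi"
      by (simp add: y_def power2_norm_eq_inner)
    then have "\<phi> k \<bullet> y = pi + \<phi> m \<bullet> y"
      by (simp add: inner_diff_left)
    then have neq: "cis (\<phi> k \<bullet> y) \<noteq> cis (\<phi> m \<bullet> y)"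
      by (simp add: cis_mult[symmetric])
    have "(\<Sum>n\<in>F. (a n * (cis (\<phi> n \<bullet> y) - cis (\<phi> m \<bullet> y))) * cis (\<phi> n \<bullet> x)) = 0" for x
    proof -
      have "(\<Sum>n\<in>F. (a n * (cis (\<phi> n \<bullet> y) - cis (\<phi> m \<bullet> y))) * cis (\<phi> n \<bullet> x)) =
          (\<Sum>n\<in>insert m F. (a n * (cis (\<phi> n \<bullet> y) - cis (\<phi> m \<bullet> y))) * cis (\<phi> n \<bullet> x))"
        using insert.hyps by simp
      also have "\<dots> = (\<Sum>n\<in>insert m F. a n * cis (\<phi> n \<bullet> (x + y))) -
          cis (\<phi> m \<bullet> y) * (\<Sum>n\<in>insert m F. a n * cis (\<phi> n \<bullet> x))"
        by (simp add: sum_distrib_left sum_subtractf[symmetric] inner_add_right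
            cis_mult[symmetric] algebra_simps del: sum.insert)
      finally show ?thesis
        using insert.prems(1) by simp
    qed
    from insert.IH[OF this that] neq show ?thesis by simp
  qed
  then have "a m * cis (\<phi> m \<bullet> 0) = 0"
    using insert.prems(1)[of 0] insert.hyps by simp
  then show ?case using others insert.prems(2) by auto
qed

text \<open>Makes the definite description in \<open>coeffs\<close> computable: two expansions of
  \<open>f\<close> are compared on the union of their supports, where characters are
  independent.\<close>

lemma coeffs_eq:
  assumes "inj \<phi>" "is_expansion \<phi> a f"
  shows "coeffs \<phi> f = a"
  unfolding coeffs_def
proof (rule the_equality)
  show "is_expansion \<phi> a f" by fact
next
  fix b assume b: "is_expansion \<phi> b f"
  define F where "F = {n. a n \<noteq> 0} \<union> {n. b n \<noteq> 0}"
  have F: "finite F"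
    using assms(2) b by (auto simp: F_def is_expansion_def)
  have expand: "f x = (\<Sum>n\<in>F. c n * cis (\<phi> n \<bullet> x))"
    if "is_expansion \<phi> c f" "{n. c n \<noteq> 0} \<subseteq> F" for c x
  proof -
    have "f x = (\<Sum>n | c n \<noteq> 0. c n * cis (\<phi> n \<bullet> x))"
      using that(1) by (simp add: is_expansion_def)
    also have "\<dots> = (\<Sum>n\<in>F. c n * cis (\<phi> n \<bullet> x))"
      by (rule sum.mono_neutral_left) (use F that(2) in auto)
    finally show ?thesis .
  qed
  have "(\<Sum>n\<in>F. (b n - a n) * cis (\<phi> n \<bullet> x)) = 0" for x
    using expand[OF assms(2), of x] expand[OF b, of x]
    by (simp add: F_def left_diff_distrib sum_subtractf)
  then have "b n - a n = 0" if "n \<in> F" for n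
    using characters_independent[OF assms(1) F, of "\<lambda>n. b n - a n"] that by blast
  moreover have "b n = a n" if "n \<notin> F" for n
    using that by (simp add: F_def)
  ultimately have "b n = a n" for n
    by (cases "n \<in> F") auto
  then show "b = a" by (rule ext)
qed

lemma sum_fiber_sum:
  fixes a :: "'j \<Rightarrow> complex" and g :: "'j \<Rightarrow> 'k"
  assumes "finite J"
  defines "c \<equiv> \<lambda>m. \<Sum>j | j \<in> J \<and> g j = m. a j"
  shows "(\<Sum>m | c m \<noteq> 0. c m * h m) = (\<Sum>j\<in>J. a j * h (g j))"
    and "finite {m. c m \<noteq> 0}"
proof -
  have sub: "{m. c m \<noteq> 0} \<subseteq> g ` J"
  proof (rule subsetI, rule ccontr)
    fix m assume m: "m \<in> {m. c m \<noteq> 0}" and "m \<notin> g ` J"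
    then have "{j. j \<in> J \<and> g j = m} = {}" by auto
    then have "c m = 0" by (simp only: c_def sum.empty)
    with m show False by simp
  qed
  then show "finite {m. c m \<noteq> 0}"
    using assms(1) finite_subset by blast
  have "(\<Sum>m | c m \<noteq> 0. c m * h m) = (\<Sum>m\<in>g ` J. c m * h m)"
    by (rule sum.mono_neutral_left) (use assms(1) sub in auto)
  also have "\<dots> = (\<Sum>m\<in>g ` J. \<Sum>j | j \<in> J \<and> g j = m. a j * h (g j))"
    by (auto simp: c_def sum_distrib_right intro!: sum.cong)
  also have "\<dots> = (\<Sum>j\<in>J. a j * h (g j))"
    by (rule sum.image_gen[OF assms(1), symmetric])
  finally show "(\<Sum>m | c m \<noteq> 0. c m * h m) = (\<Sum>j\<in>J. a j * h (g j))" .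
qed

lemma is_expansion_sum:
  assumes "finite J"
  shows "is_expansion \<phi> (\<lambda>m. \<Sum>j | j \<in> J \<and> g j = m. a j)
           (\<lambda>x. \<Sum>j\<in>J. a j * cis (\<phi> (g j) \<bullet> x))"
  unfolding is_expansion_def
  by (intro conjI ext sum_fiber_sum(2)[OF assms] sum_fiber_sum(1)[OF assms, symmetric])

lemmas coeffs_sum = coeffs_eq[OF _ is_expansion_sum]

lemma schroedinger_sum:
  assumes "inj \<phi>" "finite J"
  shows "schroedinger \<phi> t (\<lambda>x. \<Sum>j\<in>J. a j * cis (\<phi> (g j) \<bullet> x)) =
    (\<lambda>x. \<Sum>j\<in>J. a j * cis (\<phi> (g j) \<bullet> x - t * (norm (\<phi> (g j)))\<^sup>2))"
  unfolding schroedinger_def coeffs_sum[OF assms]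
  by (intro ext sum_fiber_sum(1)[OF assms(2)])

section \<open>Explicit form of the Picard iterate of a sum of characters\<close>

fun triple_out :: "'k::ab_group_add \<times> 'k \<times> 'k \<Rightarrow> 'k" where
  "triple_out (n1, n2, n3) = n1 - n2 + n3"

text \<open>The factored form of the phase contains differences of frequencies only, which makes its
  invariance under translation of the indices visible.\<close>

fun resonance :: "('k::ab_group_add \<Rightarrow> 'e::euclidean_space) \<Rightarrow> 'k \<times> 'k \<times> 'k \<Rightarrow> real" where
  "resonance \<phi> (n1, n2, n3) = 2 * ((\<phi> n1 - \<phi> n2) \<bullet> (\<phi> n3 - \<phi> n2))"

text \<open>The alternating sum of squares is the form in which the phase arises from the outer
  evolution and the three factors of the cubic term.\<close>

lemma resonance_eq:
  assumes "Modules.additive \<phi>"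
  shows "resonance \<phi> (n1, n2, n3) = (norm (\<phi> (n1 - n2 + n3)))\<^sup>2
    - (norm (\<phi> n1))\<^sup>2 + (norm (\<phi> n2))\<^sup>2 - (norm (\<phi> n3))\<^sup>2"
  by (simp add: additive.add[OF assms] additive.diff[OF assms] power2_norm_eq_inner
      inner_add_left inner_add_right inner_diff_left inner_diff_right inner_commute)

lemma cubic_sum:
  assumes "Modules.additive \<phi>"
  shows "cubic (\<lambda>x. \<Sum>n\<in>F. cis (\<phi> n \<bullet> x - \<theta> n)) =
    (\<lambda>x. \<Sum>(n1, n2, n3)\<in>F \<times> F \<times> F.
        cis (- (\<theta> n1 - \<theta> n2 + \<theta> n3)) * cis (\<phi> (n1 - n2 + n3) \<bullet> x))"
proof
  fix x
  define e where "e = (\<lambda>n. cis (\<phi> n \<bullet> x - \<theta> n))"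
  have "cubic (\<lambda>x. \<Sum>n\<in>F. cis (\<phi> n \<bullet> x - \<theta> n)) x = (\<Sum>n\<in>F. e n) * (cnj (\<Sum>n\<in>F. e n) * (\<Sum>n\<in>F. e n))"
    unfolding cubic_def e_def complex_norm_square by (simp add: algebra_simps)
  also have "\<dots> = (\<Sum>(n1, n2, n3)\<in>F \<times> F \<times> F. e n1 * (cnj (e n2) * e n3))"
    by (simp add: sum_product sum.cartesian_product cnj_sum) (simp add: sum_distrib_left sum.cartesian_product case_prod_unfold)
  also have "\<dots> = (\<Sum>(n1, n2, n3)\<in>F \<times> F \<times> F.
        cis (- (\<theta> n1 - \<theta> n2 + \<theta> n3)) * cis (\<phi> (n1 - n2 + n3) \<bullet> x))"
    by (rule sum.cong) (auto simp: e_def cis_cnj cis_mult additive.add[OF assms] additive.diff[OF assms]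
        inner_add_left inner_diff_left algebra_simps)
  finally show "cubic (\<lambda>x. \<Sum>n\<in>F. cis (\<phi> n \<bullet> x - \<theta> n)) x = \<dots>" .
qed

text \<open>For a triple, the outer evolution over time \<open>t - \<tau>\<close> and the three
  inner ones over time \<open>\<tau>\<close> combine to the phase \<open>- t * (norm (\<phi>
  (triple_out p)))\<^sup>2 + \<tau> * resonance \<phi> p\<close>. Only the second summand stays
  under the integral.\<close>

lemma picard_sum:
  fixes \<phi> :: "'k::ab_group_add \<Rightarrow> 'e::euclidean_space"
  assumes "Modules.additive \<phi>" "inj \<phi>" "finite F"
  shows "picard \<phi> t (\<lambda>x. \<Sum>n\<in>F. cis (\<phi> n \<bullet> x)) =
    (\<lambda>x. \<Sum>p\<in>F \<times> F \<times> F. (cis (- (t * (norm (\<phi> (triple_out p)))\<^sup>2)) *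
        integral {0..t} (\<lambda>\<tau>. cis (\<tau> * resonance \<phi> p))) * cis (\<phi> (triple_out p) \<bullet> x))"
proof
  fix x
  let ?J = "F \<times> F \<times> F"
  have free: "schroedinger \<phi> \<tau> (\<lambda>x. \<Sum>n\<in>F. cis (\<phi> n \<bullet> x)) =
      (\<lambda>x. \<Sum>n\<in>F. cis (\<phi> n \<bullet> x - \<tau> * (norm (\<phi> n))\<^sup>2))" for \<tau>
    using schroedinger_sum[OF assms(2,3), of \<tau> "\<lambda>_. 1" "\<lambda>n. n"] by simp
  have "schroedinger \<phi> (t - \<tau>) (cubic (schroedinger \<phi> \<tau> (\<lambda>x. \<Sum>n\<in>F. cis (\<phi> n \<bullet> x)))) x =
      (\<Sum>p\<in>?J. cis (\<phi> (triple_out p) \<bullet> x - t * (norm (\<phi> (triple_out p)))\<^sup>2) * cis (\<tau> * resonance \<phi> p))"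
    (is "?L \<tau> = ?R \<tau>") for \<tau>
  proof -
    let ?a = "\<lambda>(n1, n2, n3). cis (- (\<tau> * (norm (\<phi> n1))\<^sup>2 - \<tau> * (norm (\<phi> n2))\<^sup>2 + \<tau> * (norm (\<phi> n3))\<^sup>2))"
    have "cubic (schroedinger \<phi> \<tau> (\<lambda>x. \<Sum>n\<in>F. cis (\<phi> n \<bullet> x))) =
        (\<lambda>x. \<Sum>p\<in>?J. ?a p * cis (\<phi> (triple_out p) \<bullet> x))"
      unfolding free cubic_sum[OF assms(1)] by (auto intro!: sum.cong)
    then have "?L \<tau> = (\<Sum>p\<in>?J. ?a p * cis (\<phi> (triple_out p) \<bullet> x - (t - \<tau>) * (norm (\<phi> (triple_out p)))\<^sup>2))"
      using schroedinger_sum[OF assms(2), of ?J "t - \<tau>" ?a triple_out] assms(3) by simp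
    also have "\<dots> = ?R \<tau>"
      by (rule sum.cong)
        (auto simp: cis_mult resonance_eq[OF assms(1)] algebra_simps simp del: resonance.simps)
    finally show ?thesis .
  qed
  then have "picard \<phi> t (\<lambda>x. \<Sum>n\<in>F. cis (\<phi> n \<bullet> x)) x = integral {0..t} ?R"
    by (simp add: picard_def)
  also have "\<dots> = (\<Sum>p\<in>?J. integral {0..t} (\<lambda>\<tau>. cis (\<phi> (triple_out p) \<bullet> x - t * (norm (\<phi> (triple_out p)))\<^sup>2) *
      cis (\<tau> * resonance \<phi> p)))"
    using assms(3)
    by (intro integral_sum integrable_continuous_interval continuous_intros) auto
  also have "\<dots> = (\<Sum>p\<in>?J. (cis (- (t * (norm (\<phi> (triple_out p)))\<^sup>2)) *
        integral {0..t} (\<lambda>\<tau>. cis (\<tau> * resonance \<phi> p))) * cis (\<phi> (triple_out p) \<bullet> x))"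
    by (intro sum.cong refl) (simp add: cis_mult[symmetric] diff_conv_add_uminus algebra_simps del: add_uminus_conv_diff)
  finally show "picard \<phi> t (\<lambda>x. \<Sum>n\<in>F. cis (\<phi> n \<bullet> x)) x = \<dots>" .
qed

section \<open>Lower bound for the coefficients of the iterate\<close>

text \<open>The phase stays in \<open>[-1, 1]\<close>, and the cosine is at least 1/2 there because
  \<open>1 \<le> pi / 3\<close>.\<close>

lemma Re_integral_cis_ge:
  assumes "0 \<le> t" "t * \<bar>r\<bar> \<le> 1"
  shows "t / 2 \<le> Re (integral {0..t} (\<lambda>\<tau>. cis (\<tau> * r)))"
proof -
  have int: "(\<lambda>\<tau>. cis (\<tau> * r)) integrable_on {0..t}"
    by (intro integrable_continuous_interval continuous_intros)
  have "t / 2 = integral {0..t} (\<lambda>\<tau>. 1 / 2 :: real)"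
    using assms(1) by simp
  also have "\<dots> \<le> integral {0..t} (\<lambda>\<tau>. cos (\<tau> * r))"
  proof (rule integral_le)
    fix \<tau> assume "\<tau> \<in> {0..t}"
    then have "\<bar>\<tau> * r\<bar> \<le> 1"
      using assms(2) mult_right_mono[of \<tau> t "\<bar>r\<bar>"] by (simp add: abs_mult)
    then have "cos (pi / 3) \<le> cos \<bar>\<tau> * r\<bar>"
      using pi_gt3 by (intro cos_monotone_0_pi_le) auto
    then show "1 / 2 \<le> cos (\<tau> * r)"
      by (simp add: cos_60)
  qed (auto intro!: integrable_continuous_interval continuous_intros)
  also have "\<dots> = Re (integral {0..t} (\<lambda>\<tau>. cis (\<tau> * r)))"
    using integral_linear[OF int bounded_linear_Re] by (simp add: o_def)
  finally show ?thesis .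
qed

text \<open>In \<open>cluster \<phi> sz b C N S0 S v\<close>, frequencies are bounded on \<open>S\<close> itself, whereas sizes are
  measured after translation by \<open>v\<close>.\<close>

definition cluster ::
  "('k::ab_group_add \<Rightarrow> 'e::euclidean_space) \<Rightarrow> ('k \<Rightarrow> real) \<Rightarrow> nat \<Rightarrow> real \<Rightarrow> nat \<Rightarrow> 'k set \<Rightarrow> 'k set \<Rightarrow> 'k \<Rightarrow> bool"
  where "cluster \<phi> sz b C N S0 S v \<longleftrightarrow> finite S \<and> S0 \<subseteq> S \<and>
     (\<forall>k\<in>S0. \<forall>l\<in>S0. \<forall>m\<in>S0. k - l + m \<in> S) \<and>
     (\<forall>n\<in>S. norm (\<phi> n) \<le> C \<and> real N \<le> 1 + sz (v + n) \<and> 1 + sz (v + n) \<le> C * real N) \<and>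
     real N ^ b \<le> real (card S0) \<and> real (card S) \<le> C * real (card S0)"

definition clustering :: "('k::ab_group_add \<Rightarrow> 'e::euclidean_space) \<Rightarrow> ('k \<Rightarrow> real) \<Rightarrow> nat \<Rightarrow> bool" where
  "clustering \<phi> sz b \<longleftrightarrow> (\<exists>C. \<forall>N\<ge>1. \<exists>S0 S v. cluster \<phi> sz b C N S0 S v)"

text \<open>By additivity the translation \<open>v\<close> drops out of both differences of
  frequencies. Each has norm at most \<open>2 * C\<close>, and Cauchy-Schwarz gives
  \<open>2 * (2 * C)\<^sup>2\<close>.\<close>

lemma abs_resonance_le:
  assumes "Modules.additive \<phi>"
    and "p \<in> (+) v ` S \<times> (+) v ` S \<times> (+) v ` S" "\<And>n. n \<in> S \<Longrightarrow> norm (\<phi> n) \<le> C"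
  shows "\<bar>resonance \<phi> p\<bar> \<le> 8 * C\<^sup>2"
proof -
  obtain n1 n2 n3 where p: "p = (v + n1, v + n2, v + n3)" "n1 \<in> S" "n2 \<in> S" "n3 \<in> S"
    using assms(2) by auto
  have "norm (\<phi> n1 - \<phi> n2) \<le> 2 * C" "norm (\<phi> n3 - \<phi> n2) \<le> 2 * C"
    using assms(3)[OF p(2)] assms(3)[OF p(3)] assms(3)[OF p(4)]
      norm_triangle_ineq4[of "\<phi> n1" "\<phi> n2"] norm_triangle_ineq4[of "\<phi> n3" "\<phi> n2"]
    by linarith+
  then have "\<bar>(\<phi> n1 - \<phi> n2) \<bullet> (\<phi> n3 - \<phi> n2)\<bar> \<le> 2 * C * (2 * C)"
    by (intro order_trans[OF Cauchy_Schwarz_ineq2] mult_mono)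
      (use order_trans[OF norm_ge_zero assms(3)[OF p(2)]] in auto)
  then show ?thesis
    by (simp add: p(1) additive.add[OF assms(1)] abs_mult power2_eq_square)
qed

text \<open>The coefficient is a sum over the triples with output \<open>v + m\<close>. Up to a
  common factor of modulus one, every summand has real part at least \<open>t / 2\<close>, so it
  suffices to count triples.\<close>

lemma cmod_coeffs_picard_ge:
  fixes \<phi> :: "'k::ab_group_add \<Rightarrow> 'e::euclidean_space"
  assumes "Modules.additive \<phi>" "inj \<phi>" "finite S" "S0 \<subseteq> S"
    and closed: "\<And>k l m. k \<in> S0 \<Longrightarrow> l \<in> S0 \<Longrightarrow> m \<in> S0 \<Longrightarrow> k - l + m \<in> S"
    and bound: "\<And>n. n \<in> S \<Longrightarrow> norm (\<phi> n) \<le> C"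
    and t: "0 \<le> t" "t * (8 * C\<^sup>2) \<le> 1"
    and "m \<in> S0"
  shows "t / 2 * (real (card S0))\<^sup>2 \<le>
    cmod (coeffs \<phi> (picard \<phi> t (\<lambda>x. \<Sum>n\<in>(+) v ` S. cis (\<phi> n \<bullet> x))) (v + m))"
proof -
  define F where "F = (+) v ` S"
  define I where "I p = integral {0..t} (\<lambda>\<tau>. cis (\<tau> * resonance \<phi> p))" for p
  define P where "P = {p. p \<in> F \<times> F \<times> F \<and> triple_out p = v + m}"
  have F: "finite F" using assms(3) by (simp add: F_def)
  then have P: "finite P"
    by (rule_tac finite_subset[of _ "F \<times> F \<times> F"]) (auto simp: P_def)
  \<comment> \<open>The first two entries range freely over \<open>S0\<close>; the third is then
    forced by the output, and \<open>closed\<close> puts it in \<open>v + S\<close>.\<close>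
  let ?h = "\<lambda>(k, l). (v + k, v + l, v + (m - k + l))"
  have "inj_on ?h (S0 \<times> S0)"
    by (auto simp: inj_on_def)
  moreover have "?h ` (S0 \<times> S0) \<subseteq> P"
  proof (rule image_subsetI)
    fix q assume "q \<in> S0 \<times> S0"
    then obtain k l where q: "q = (k, l)" "k \<in> S0" "l \<in> S0" by auto
    have "v + k \<in> F" "v + l \<in> F" "v + (m - k + l) \<in> F"
      unfolding F_def using q assms(4) closed \<open>m \<in> S0\<close> by blast+
    then show "?h q \<in> P"
      by (simp add: q(1) P_def algebra_simps)
  qed
  ultimately have "card (S0 \<times> S0) \<le> card P"
    using P card_inj_on_le by blast
  then have card: "(real (card S0))\<^sup>2 \<le> real (card P)"
    by (simp add: card_cartesian_product power2_eq_square flip: of_nat_mult)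
  have "t / 2 * (real (card S0))\<^sup>2 \<le> (\<Sum>p\<in>P. t / 2)"
    using card t(1) mult_left_mono[OF card, of "t / 2"] by (simp add: mult.commute)
  also have "\<dots> \<le> (\<Sum>p\<in>P. Re (I p))"
    unfolding I_def
  proof (intro sum_mono Re_integral_cis_ge t)
    fix p assume "p \<in> P"
    then have "\<bar>resonance \<phi> p\<bar> \<le> 8 * C\<^sup>2"
      using abs_resonance_le[OF assms(1) _ bound, of p v S] by (auto simp: P_def F_def)
    then show "t * \<bar>resonance \<phi> p\<bar> \<le> 1"
      using t mult_left_mono order_trans by blast
  qed
  also have "\<dots> \<le> cmod (\<Sum>p\<in>P. I p)"
    using complex_Re_le_cmod[of "\<Sum>p\<in>P. I p"] by simp
  also have "\<dots> = cmod (\<Sum>p\<in>P. cis (- (t * (norm (\<phi> (triple_out p)))\<^sup>2)) * I p)"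
  proof -
    \<comment> \<open>The factor in front of \<open>I p\<close> depends on the output alone, so it
      is constant on \<open>P\<close>.\<close>
    have "(\<Sum>p\<in>P. cis (- (t * (norm (\<phi> (triple_out p)))\<^sup>2)) * I p) =
        cis (- (t * (norm (\<phi> (v + m)))\<^sup>2)) * (\<Sum>p\<in>P. I p)"
      by (auto simp: P_def sum_distrib_left intro!: sum.cong)
    then show ?thesis by (simp add: norm_mult)
  qed
  also have "(\<Sum>p\<in>P. cis (- (t * (norm (\<phi> (triple_out p)))\<^sup>2)) * I p) =
      coeffs \<phi> (picard \<phi> t (\<lambda>x. \<Sum>n\<in>F. cis (\<phi> n \<bullet> x))) (v + m)"
    using coeffs_sum[OF assms(2), where J = "F \<times> F \<times> F" and g = triple_out] F
    by (simp add: picard_sum[OF assms(1,2) F] I_def P_def)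
  finally show ?thesis by (simp add: F_def)
qed

section \<open>Sobolev norms of trigonometric polynomials\<close>

lemma sobolev_norm_power2:
  "(sobolev_norm \<phi> sz s f)\<^sup>2 =
    (\<Sum>n | coeffs \<phi> f n \<noteq> 0. (1 + sz n) powr (2 * s) * (cmod (coeffs \<phi> f n))\<^sup>2)"
  unfolding sobolev_norm_def by (intro real_sqrt_pow2 sum_nonneg) simp

lemma sobolev_norm_nonneg: "0 \<le> sobolev_norm \<phi> sz s f"
  unfolding sobolev_norm_def by (intro real_sqrt_ge_zero sum_nonneg) simp

lemma trig_polys_finite_coeffs:
  assumes "inj \<phi>" "f \<in> trig_polys \<phi>"
  shows "finite {n. coeffs \<phi> f n \<noteq> 0}"
proof -
  obtain a where a: "is_expansion \<phi> a f"
    using assms(2) by (auto simp: trig_polys_def)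
  show ?thesis
    using a unfolding coeffs_eq[OF assms(1) a] by (simp add: is_expansion_def)
qed

text \<open>Membership in \<open>trig_polys \<phi>\<close> makes the support finite; the sum over an
  infinite support would be 0 by convention.\<close>

lemma sobolev_norm_power2_ge:
  assumes "inj \<phi>" "f \<in> trig_polys \<phi>" "finite M"
  shows "(\<Sum>n\<in>M. (1 + sz n) powr (2 * s) * (cmod (coeffs \<phi> f n))\<^sup>2) \<le> (sobolev_norm \<phi> sz s f)\<^sup>2"
proof -
  have "(\<Sum>n\<in>M. (1 + sz n) powr (2 * s) * (cmod (coeffs \<phi> f n))\<^sup>2) =
      (\<Sum>n\<in>M \<inter> {n. coeffs \<phi> f n \<noteq> 0}. (1 + sz n) powr (2 * s) * (cmod (coeffs \<phi> f n))\<^sup>2)"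
    by (rule sum.mono_neutral_right) (use assms(3) in auto)
  also have "\<dots> \<le> (sobolev_norm \<phi> sz s f)\<^sup>2"
    unfolding sobolev_norm_power2
    by (rule sum_mono2) (use trig_polys_finite_coeffs[OF assms(1,2)] in auto)
  finally show ?thesis .
qed

lemma sum_characters_in_trig_polys:
  assumes "finite F"
  shows "(\<lambda>x. \<Sum>n\<in>F. cis (\<phi> n \<bullet> x)) \<in> trig_polys \<phi>"
  using is_expansion_sum[OF assms, where \<phi> = \<phi> and g = "\<lambda>n. n" and a = "\<lambda>_. 1"] by (auto simp: trig_polys_def)

lemma picard_sum_in_trig_polys:
  fixes \<phi> :: "'k::ab_group_add \<Rightarrow> 'e::euclidean_space"
  assumes "Modules.additive \<phi>" "inj \<phi>" "finite F"
  shows "picard \<phi> t (\<lambda>x. \<Sum>n\<in>F. cis (\<phi> n \<bullet> x)) \<in> trig_polys \<phi>"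
  unfolding picard_sum[OF assms] trig_polys_def
  by (intro CollectI exI, rule is_expansion_sum[where g = triple_out]) (use assms(3) in auto)

lemma sobolev_norm_sum_characters:
  assumes "inj \<phi>" "finite F"
  shows "(sobolev_norm \<phi> sz s (\<lambda>x. \<Sum>n\<in>F. cis (\<phi> n \<bullet> x)))\<^sup>2 = (\<Sum>n\<in>F. (1 + sz n) powr (2 * s))"
proof -
  have fib: "{j. j \<in> F \<and> j = m} = (if m \<in> F then {m} else {})" for m
    by auto
  have "coeffs \<phi> (\<lambda>x. \<Sum>n\<in>F. cis (\<phi> n \<bullet> x)) = (\<lambda>m. if m \<in> F then 1 else 0)"
    using coeffs_sum[OF assms, where g = "\<lambda>n. n" and a = "\<lambda>_. 1"] by (simp add: fib fun_eq_iff)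
  then show ?thesis
    unfolding sobolev_norm_power2 by (simp cong: if_cong)
qed

text \<open>Since \<open>s\<close> may be negative, the Sobolev weight may increase or decrease with
  the size. The exponent \<open>\<bar>p\<bar>\<close> gives one constant for both signs.\<close>

lemma powr_comparable:
  fixes N C w p :: real
  assumes "0 < N" "1 \<le> C" "N \<le> w" "w \<le> C * N"
  shows "w powr p \<le> C powr \<bar>p\<bar> * N powr p" "N powr p \<le> C powr \<bar>p\<bar> * w powr p"
proof -
  have C: "1 \<le> C powr \<bar>p\<bar>"
    using assms(2) by (simp add: ge_one_powr_ge_zero)
  show "w powr p \<le> C powr \<bar>p\<bar> * N powr p"
  proof (cases "0 \<le> p")
    case True
    then show ?thesis
      using powr_mono2[of p w "C * N"] assms by (simp add: powr_mult)
  next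
    case False
    then have "w powr p \<le> 1 * N powr p"
      using powr_mono2'[of p N w] assms by simp
    also have "\<dots> \<le> C powr \<bar>p\<bar> * N powr p"
      using C by (intro mult_right_mono) auto
    finally show ?thesis .
  qed
  show "N powr p \<le> C powr \<bar>p\<bar> * w powr p"
  proof (cases "0 \<le> p")
    case True
    then have "N powr p \<le> 1 * w powr p"
      using powr_mono2[of p N w] assms by simp
    also have "\<dots> \<le> C powr \<bar>p\<bar> * w powr p"
      using C by (intro mult_right_mono) auto
    finally show ?thesis .
  next
    case False
    then have "C powr \<bar>p\<bar> * (C * N) powr p \<le> C powr \<bar>p\<bar> * w powr p"
      using powr_mono2'[of p w "C * N"] assms by (intro mult_left_mono) auto
    moreover have "C powr \<bar>p\<bar> * (C * N) powr p = N powr p"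
      using False assms by (simp add: powr_mult powr_minus)
    ultimately show ?thesis by simp
  qed
qed

section \<open>From clusters to unboundedness\<close>

lemma clustering_imp_unbounded:
  fixes \<phi> :: "'k::ab_group_add \<Rightarrow> 'e::euclidean_space"
  assumes \<phi>: "Modules.additive \<phi>" "inj \<phi>" and "clustering \<phi> sz b" and s: "s < real b / 2" and "0 < T"
  shows "\<not> (\<exists>K :: real. \<forall>f \<in> trig_polys \<phi>.
           (SUP t\<in>{0..T}. ereal (sobolev_norm \<phi> sz s (picard \<phi> t f)))
           \<le> ereal (K * sobolev_norm \<phi> sz s f ^ 3))"
proof
  assume "\<exists>K :: real. \<forall>f \<in> trig_polys \<phi>. (SUP t\<in>{0..T}. ereal (sobolev_norm \<phi> sz s (picard \<phi> t f)))
           \<le> ereal (K * sobolev_norm \<phi> sz s f ^ 3)"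
  then obtain K where sup: "\<And>f. f \<in> trig_polys \<phi> \<Longrightarrow>
      (SUP t\<in>{0..T}. ereal (sobolev_norm \<phi> sz s (picard \<phi> t f))) \<le> ereal (K * sobolev_norm \<phi> sz s f ^ 3)"
    by blast
  have K: "sobolev_norm \<phi> sz s (picard \<phi> t f) \<le> K * sobolev_norm \<phi> sz s f ^ 3"
    if "f \<in> trig_polys \<phi>" "t \<in> {0..T}" for f t
    using order_trans[OF SUP_upper[OF that(2)] sup[OF that(1)]] by simp
  obtain C where C: "\<And>N. N \<ge> 1 \<Longrightarrow> \<exists>S0 S v. cluster \<phi> sz b C N S0 S v"
    using assms(3) unfolding clustering_def by blast
  \<comment> \<open>This time depends on \<open>C\<close> and \<open>T\<close> but not on
    \<open>N\<close>. The summand 1 keeps the denominator positive before anything is known about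
    \<open>C\<close>.\<close>
  define t where "t = min T (1 / (8 * C\<^sup>2 + 1))"
  have pos: "0 < 8 * C\<^sup>2 + 1"
    by (simp add: add_nonneg_pos)
  then have t: "0 < t" "t \<in> {0..T}"
    using \<open>0 < T\<close> by (simp_all add: t_def)
  have "t \<le> 1 / (8 * C\<^sup>2 + 1)"
    by (simp add: t_def)
  then have "t * (8 * C\<^sup>2 + 1) \<le> 1"
    using pos by (simp only: pos_le_divide_eq)
  then have "t * (8 * C\<^sup>2) + t \<le> 1"
    by (simp only: distrib_left mult_1_right)
  then have tC: "t * (8 * C\<^sup>2) \<le> 1"
    using t(1) by linarith
  define A where "A = C powr \<bar>2 * s\<bar>"
  \<comment> \<open>The constant that remains when the comparison of the two norms is divided by
    \<open>X ^ 3 * W * t\<^sup>2 / (4 * A)\<close>; it does not depend on \<open>N\<close>.\<close>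
  define D where "D = 4 * K\<^sup>2 * C ^ 3 * A ^ 4 / t\<^sup>2"
  have bounded: "real N powr (2 * real b - 4 * s) \<le> D" if N: "N \<ge> 1" for N
  proof -
    obtain S0 S v where cluster: "cluster \<phi> sz b C N S0 S v"
      using C[OF N] by blast
    then have S: "finite S" "S0 \<subseteq> S" "\<And>k l m. k \<in> S0 \<Longrightarrow> l \<in> S0 \<Longrightarrow> m \<in> S0 \<Longrightarrow> k - l + m \<in> S"
      and \<phi>C: "\<And>n. n \<in> S \<Longrightarrow> norm (\<phi> n) \<le> C"
      and sz: "\<And>n. n \<in> S \<Longrightarrow> real N \<le> 1 + sz (v + n)" "\<And>n. n \<in> S \<Longrightarrow> 1 + sz (v + n) \<le> C * real N"
      and card: "real N ^ b \<le> real (card S0)" "real (card S) \<le> C * real (card S0)"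
      by (simp_all add: cluster_def)
    define f where "f = (\<lambda>x. \<Sum>n\<in>(+) v ` S. cis (\<phi> n \<bullet> x))"
    define X where "X = real (card S0)"
    define W where "W = real N powr (2 * s)"
    have Npos: "0 < real N" using N by simp
    then have W: "0 < W" by (simp add: W_def)
    have "0 < real N ^ b" using Npos by (rule zero_less_power)
    then have X: "0 < X" using card(1) unfolding X_def by linarith
    \<comment> \<open>The two size bounds at a single point of \<open>S0\<close> force
      \<open>1 \<le> C\<close>.\<close>
    then obtain m where "m \<in> S0" by (auto simp: X_def card_gt_0_iff)
    then have "1 * real N \<le> C * real N"
      using sz S(2) by force
    with Npos have C1: "1 \<le> C" by simp
    then have A: "0 < A" by (simp add: A_def)
    have fin: "finite ((+) v ` S)" using S(1) by simp
    have f: "f \<in> trig_polys \<phi>"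
      unfolding f_def by (rule sum_characters_in_trig_polys[OF fin])
    have weights: "(1 + sz (v + n)) powr (2 * s) \<le> A * W" "W / A \<le> (1 + sz (v + n)) powr (2 * s)"
      if "n \<in> S" for n
      using powr_comparable[OF Npos C1 sz[OF that], of "2 * s"] A
      by (auto simp: A_def W_def field_simps)
    have "(sobolev_norm \<phi> sz s f)\<^sup>2 = (\<Sum>n\<in>S. (1 + sz (v + n)) powr (2 * s))"
      unfolding f_def sobolev_norm_sum_characters[OF \<phi>(2) fin] by (simp add: sum.reindex)
    also have "\<dots> \<le> real (card S) * (A * W)"
      using weights(1) by (rule sum_bounded_above)
    also have "\<dots> \<le> C * X * (A * W)"
      using card(2) A W by (intro mult_right_mono) (auto simp: X_def)
    finally have upper: "(sobolev_norm \<phi> sz s f)\<^sup>2 \<le> C * X * (A * W)" .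
    have "X * (W / A * (t / 2 * X\<^sup>2)\<^sup>2) = (\<Sum>n\<in>S0. W / A * (t / 2 * X\<^sup>2)\<^sup>2)"
      by (simp add: X_def)
    also have "\<dots> \<le> (\<Sum>n\<in>S0. (1 + sz (v + n)) powr (2 * s) * (cmod (coeffs \<phi> (picard \<phi> t f) (v + n)))\<^sup>2)"
    proof (intro sum_mono mult_mono power_mono)
      fix n assume n: "n \<in> S0"
      then show "W / A \<le> (1 + sz (v + n)) powr (2 * s)"
        using weights(2) S(2) by auto
      show "t / 2 * X\<^sup>2 \<le> cmod (coeffs \<phi> (picard \<phi> t f) (v + n))"
        unfolding X_def f_def using t
        by (intro cmod_coeffs_picard_ge[OF \<phi> S \<phi>C _ tC n]) auto
    qed (use t(1) in auto)
    also have "\<dots> = (\<Sum>n\<in>(+) v ` S0. (1 + sz n) powr (2 * s) * (cmod (coeffs \<phi> (picard \<phi> t f) n))\<^sup>2)"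
      by (simp add: sum.reindex)
    also have "\<dots> \<le> (sobolev_norm \<phi> sz s (picard \<phi> t f))\<^sup>2"
      unfolding f_def using S(1,2)
      by (intro sobolev_norm_power2_ge picard_sum_in_trig_polys \<phi> fin) (auto intro: finite_subset)
    also have "\<dots> \<le> (K * sobolev_norm \<phi> sz s f ^ 3)\<^sup>2"
      by (intro power_mono K f t sobolev_norm_nonneg)
    also have "\<dots> = K\<^sup>2 * ((sobolev_norm \<phi> sz s f)\<^sup>2) ^ 3"
      by (simp add: power_mult_distrib flip: power_mult)
    also have "\<dots> \<le> K\<^sup>2 * (C * X * (A * W)) ^ 3"
      by (intro mult_left_mono power_mono upper) auto
    finally have "X * (W / A * (t / 2 * X\<^sup>2)\<^sup>2) \<le> K\<^sup>2 * (C * X * (A * W)) ^ 3" .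
    then have "(X ^ 3 * W * t\<^sup>2 / (4 * A)) * X\<^sup>2 \<le> (X ^ 3 * W * t\<^sup>2 / (4 * A)) * (D * W\<^sup>2)"
      using t(1) A by (simp add: D_def power_mult_distrib power_divide field_simps eval_nat_numeral)
    then have "X\<^sup>2 \<le> D * W\<^sup>2"
      using X W t(1) A by (subst (asm) mult_le_cancel_left_pos) auto
    moreover have "real N powr (2 * real b) \<le> X\<^sup>2"
    proof -
      have "real N powr (2 * real b) = (real N ^ b)\<^sup>2"
        using powr_realpow[OF Npos, of "2 * b"] by (simp add: power_mult[symmetric] mult.commute)
      also have "\<dots> \<le> X\<^sup>2"
        using card(1) by (intro power_mono) (auto simp: X_def)
      finally show ?thesis .
    qed
    moreover have "W\<^sup>2 = real N powr (4 * s)"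
      by (simp add: W_def power2_eq_square flip: powr_add)
    ultimately have "real N powr (2 * real b) \<le> D * real N powr (4 * s)"
      by simp
    then show ?thesis
      using Npos by (simp add: powr_diff divide_le_eq)
  qed
  \<comment> \<open>The exponent is positive exactly because \<open>s < b / 2\<close>, so the left
    side of \<open>bounded\<close> exceeds \<open>D\<close> for large \<open>N\<close>.\<close>
  have "filterlim (\<lambda>N. real N powr (2 * real b - 4 * s)) at_top sequentially"
    using s by (intro filterlim_compose[OF real_powr_at_top filterlim_real_sequentially]) simp
  then have "eventually (\<lambda>N. D < real N powr (2 * real b - 4 * s) \<and> N \<ge> 1) sequentially"
    by (intro eventually_conj eventually_ge_at_top) (simp add: filterlim_at_top_dense)
  then obtain N where "D < real N powr (2 * real b - 4 * s)" "N \<ge> 1"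
    by (auto simp: eventually_sequentially)
  with bounded show False by fastforce
qed

section \<open>Additivity and injectivity of the frequency maps\<close>

lemma freq1_eq_sum: "freq1 \<omega> n = (\<Sum>i\<in>UNIV. of_int (n $ i) * \<omega> $ i)"
  by (simp add: freq1_def int_vec_def inner_vec_def)

lemma int_vec_add: "int_vec (m + n) = int_vec m + int_vec n"
  by (simp add: int_vec_def vec_eq_iff)

lemma additive_freq1: "Modules.additive (freq1 \<omega>)"
  by unfold_locales (simp add: freq1_def int_vec_add inner_add_left)

lemma inj_freq1:
  fixes \<omega> :: "real ^ 'n"
  assumes "non_resonant \<omega>"
  shows "inj (freq1 \<omega>)"
proof (rule injI)
  fix m n assume "freq1 \<omega> m = freq1 \<omega> n"
  then have eq: "(\<Sum>i\<in>UNIV. of_rat (of_int (m $ i - n $ i)) * \<omega> $ i) = 0"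
    \<comment> \<open>The integer relation is written with rational coefficients, the form in which
      \<open>non_resonant\<close> can be applied.\<close>
    by (simp add: freq1_eq_sum of_rat_diff left_diff_distrib sum_subtractf)
  have independent: "\<forall>i. q i = 0" if "(\<Sum>i\<in>UNIV. of_rat (q i) * \<omega> $ i) = 0" for q :: "'n \<Rightarrow> rat"
    using assms that by (simp add: non_resonant_def)
  have "\<forall>i. of_int (m $ i - n $ i) = (0 :: rat)"
    using independent[of "\<lambda>i. of_int (m $ i - n $ i)", OF eq] .
  then show "m = n" by (simp add: vec_eq_iff)
qed

lemma freq2_eq: "freq2 \<omega>1 \<omega>2 n = (freq1 \<omega>1 (fst n), freq1 \<omega>2 (snd n))"
  by (simp add: freq2_def freq1_def)

lemma additive_freq2: "Modules.additive (freq2 \<omega>1 \<omega>2)"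
  by unfold_locales (simp add: freq2_eq additive.add[OF additive_freq1])

lemma inj_freq2:
  assumes "non_resonant \<omega>1" "non_resonant \<omega>2"
  shows "inj (freq2 \<omega>1 \<omega>2)"
  using inj_freq1[OF assms(1)] inj_freq1[OF assms(2)]
  by (auto simp: inj_def freq2_eq prod_eq_iff)

section \<open>Counting lattice points in a slab\<close>

text \<open>The coordinate at \<open>i0\<close> is constrained only through the frequency, which
  leaves boundedly many values for it once the others are fixed. The slab thus has as many free
  directions as the exponent \<open>b\<close> demands.\<close>

definition slab :: "real ^ 'n \<Rightarrow> 'n \<Rightarrow> nat \<Rightarrow> real \<Rightarrow> (int ^ 'n) set" where
  "slab \<omega> i0 R h = {n. (\<forall>i. i \<noteq> i0 \<longrightarrow> \<bar>n $ i\<bar> \<le> int R) \<and> \<bar>freq1 \<omega> n\<bar> \<le> h}"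

abbreviation off_axis :: "'n \<Rightarrow> nat \<Rightarrow> ('n \<Rightarrow> int) set" where
  "off_axis i0 R \<equiv> Pi\<^sub>E (- {i0}) (\<lambda>_. {- int R..int R})"

lemma card_off_axis: "card (off_axis (i0 :: 'n::finite) R) = (2 * R + 1) ^ (CARD('n) - 1)"
proof -
  have "card (off_axis i0 R) = nat (2 * int R + 1) ^ (CARD('n) - 1)"
    by (simp add: card_PiE Compl_eq_Diff_UNIV)
  then show ?thesis by (simp add: nat_add_distrib nat_mult_distrib)
qed

lemma freq1_split:
  "freq1 \<omega> n = of_int (n $ i0) * \<omega> $ i0 + (\<Sum>i\<in>- {i0}. of_int (n $ i) * \<omega> $ i)"
  unfolding freq1_eq_sum by (subst sum.remove[of UNIV i0]) (simp_all add: Compl_eq_Diff_UNIV)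

context
  fixes \<omega> :: "real ^ 'n" and i0 :: 'n
  assumes \<omega>: "\<And>i. \<omega> $ i \<in> {1/2<..1}"
begin

text \<open>Given the other coordinates \<open>k\<close>, the frequency vanishes where the real
  coordinate along \<open>i0\<close> equals \<open>- offset k\<close>.\<close>

definition offset :: "('n \<Rightarrow> int) \<Rightarrow> real" where
  "offset k = (\<Sum>i\<in>- {i0}. of_int (k i) * \<omega> $ i) / \<omega> $ i0"

lemma freq1_offset: "freq1 \<omega> n = (of_int (n $ i0) + offset (($) n)) * \<omega> $ i0"
  using \<omega>[of i0] by (simp add: freq1_split[of _ _ i0] offset_def field_simps)

text \<open>The factor 2 comes from \<open>\<omega> $ i0 > 1/2\<close>.\<close>

lemma abs_axis_plus_offset_le:
  assumes "\<bar>freq1 \<omega> n\<bar> \<le> h"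
  shows "\<bar>of_int (n $ i0) + offset (($) n)\<bar> \<le> 2 * h"
proof -
  have "\<bar>of_int (n $ i0) + offset (($) n)\<bar> * (1/2) \<le> \<bar>of_int (n $ i0) + offset (($) n)\<bar> * \<omega> $ i0"
    using \<omega>[of i0] by (intro mult_left_mono) auto
  also have "\<dots> = \<bar>freq1 \<omega> n\<bar>"
    using \<omega>[of i0] by (simp add: freq1_offset abs_mult)
  finally show ?thesis using assms by simp
qed

lemma offset_restrict: "offset (restrict k (- {i0})) = offset k"
  by (simp add: offset_def)

text \<open>Along \<open>i0\<close>, the frequency contributes at most \<open>R\<close> and each of
  the other coordinates at most \<open>R\<close>, as the components of \<open>\<omega>\<close> are
  at most 1. Dividing by \<open>\<omega> $ i0 > 1/2\<close> doubles the total
  \<open>CARD('n) * R\<close>.\<close>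

lemma slab_subset_box:
  assumes "1 \<le> R" "h \<le> real R" "n \<in> slab \<omega> i0 R h"
  shows "\<bar>n $ i\<bar> \<le> int (2 * CARD('n) * R)"
proof (cases "i = i0")
  case False
  have "\<bar>n $ i\<bar> \<le> int R" using assms(3) False by (simp add: slab_def)
  also have "R \<le> 2 * CARD('n) * R" by simp
  finally show ?thesis by simp
next
  case True
  have "\<bar>\<Sum>i\<in>- {i0}. of_int (n $ i) * \<omega> $ i\<bar> \<le> (\<Sum>i\<in>- {i0}. real R)"
  proof (intro order_trans[OF sum_abs] sum_mono)
    fix i assume "i \<in> - {i0}"
    then have "\<bar>n $ i\<bar> \<le> int R" using assms(3) by (simp add: slab_def)
    then have "real_of_int \<bar>n $ i\<bar> \<le> real_of_int (int R)"
      by (simp only: of_int_le_iff)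
    then have "\<bar>real_of_int (n $ i)\<bar> * \<bar>\<omega> $ i\<bar> \<le> real R * 1"
      using \<omega>[of i] by (intro mult_mono) auto
    then show "\<bar>of_int (n $ i) * \<omega> $ i\<bar> \<le> real R"
      by (simp add: abs_mult)
  qed
  also have "\<dots> = (real CARD('n) - 1) * real R"
    by (simp add: Compl_eq_Diff_UNIV of_nat_diff Suc_le_eq)
  finally have "\<bar>of_int (n $ i0) * \<omega> $ i0\<bar> \<le> (real CARD('n) - 1) * real R + real R"
    using assms(2,3) unfolding slab_def freq1_split[of \<omega> n i0] mem_Collect_eq by linarith
  also have "\<dots> = real CARD('n) * real R"
    by (simp add: algebra_simps)
  finally have "\<bar>real_of_int (n $ i0)\<bar> * \<omega> $ i0 \<le> real CARD('n) * real R"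
    using \<omega>[of i0] by (simp add: abs_mult)
  moreover have "\<bar>real_of_int (n $ i0)\<bar> * (1/2) \<le> \<bar>real_of_int (n $ i0)\<bar> * \<omega> $ i0"
    using \<omega>[of i0] by (intro mult_left_mono) auto
  ultimately have "real_of_int \<bar>n $ i0\<bar> \<le> real_of_int (int (2 * CARD('n) * R))"
    by simp
  then show ?thesis using True by (simp only: of_int_le_iff)
qed

text \<open>The off-axis coordinates determine the offset, so together with
  \<open>n $ i0 + \<lfloor>offset (($) n)\<rfloor>\<close> they determine \<open>n\<close>. It
  remains to count the possible pairs.\<close>

lemma card_slab_le: "finite (slab \<omega> i0 R h)" "card (slab \<omega> i0 R h) \<le> (2 * R + 1) ^ (CARD('n) - 1) * nat (2 * \<lfloor>2 * h\<rfloor> + 2)"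
proof -
  let ?g = "\<lambda>n :: int ^ 'n. (restrict (($) n) (- {i0}), n $ i0 + \<lfloor>offset (($) n)\<rfloor>)"
  \<comment> \<open>Rounding down a number in \<open>[-2 * h, 2 * h]\<close> can give
    \<open>- \<lfloor>2 * h\<rfloor> - 1\<close>, namely when \<open>2 * h\<close> is not an
    integer; hence the asymmetric interval.\<close>
  let ?B = "off_axis i0 R \<times> {- \<lfloor>2 * h\<rfloor> - 1..\<lfloor>2 * h\<rfloor>}"
  have inj: "inj_on ?g (slab \<omega> i0 R h)"
  proof (rule inj_onI)
    fix m n assume eq: "?g m = ?g n"
    then have res: "restrict (($) m) (- {i0}) = restrict (($) n) (- {i0})" by simp
    then have "offset (($) m) = offset (($) n)"
      by (metis offset_restrict)
    with eq have "m $ i0 = n $ i0" by simp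
    moreover have "m $ i = n $ i" if "i \<noteq> i0" for i
      using fun_cong[OF res, of i] that by simp
    ultimately show "m = n" by (metis vec_eq_iff)
  qed
  have sub: "?g ` slab \<omega> i0 R h \<subseteq> ?B"
  proof (rule image_subsetI)
    fix n assume n: "n \<in> slab \<omega> i0 R h"
    then have "\<bar>of_int (n $ i0) + offset (($) n)\<bar> \<le> 2 * h"
      by (intro abs_axis_plus_offset_le) (simp add: slab_def)
    then have "n $ i0 + \<lfloor>offset (($) n)\<rfloor> \<in> {- \<lfloor>2 * h\<rfloor> - 1..\<lfloor>2 * h\<rfloor>}"
      unfolding atLeastAtMost_iff by linarith
    moreover have "restrict (($) n) (- {i0}) \<in> off_axis i0 R"
      using n by (force simp: slab_def)
    ultimately show "?g n \<in> ?B" by simp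
  qed
  have fin: "finite ?B" by (intro finite_cartesian_product finite_PiE) auto
  show "finite (slab \<omega> i0 R h)"
    using finite_subset[OF sub fin] inj finite_imageD by blast
  have "card (slab \<omega> i0 R h) \<le> card ?B"
    using card_inj_on_le[OF inj sub fin] .
  also have "\<dots> = (2 * R + 1) ^ (CARD('n) - 1) * nat (2 * \<lfloor>2 * h\<rfloor> + 2)"
    by (simp add: card_cartesian_product card_off_axis)
  finally show "card (slab \<omega> i0 R h) \<le> (2 * R + 1) ^ (CARD('n) - 1) * nat (2 * \<lfloor>2 * h\<rfloor> + 2)" .
qed

text \<open>Every choice of off-axis coordinates extends to a point of the slab: with
  \<open>- \<lfloor>offset k\<rfloor>\<close> along \<open>i0\<close>, the frequency is the
  fractional part of the offset times \<open>\<omega> $ i0 \<le> 1\<close>.\<close>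

lemma card_slab_ge: "(2 * R + 1) ^ (CARD('n) - 1) \<le> card (slab \<omega> i0 R 1)"
proof -
  let ?g = "\<lambda>n :: int ^ 'n. restrict (($) n) (- {i0})"
  have "off_axis i0 R \<subseteq> ?g ` slab \<omega> i0 R 1"
  proof
    fix k assume k: "k \<in> off_axis i0 R"
    define n :: "int ^ 'n" where "n = (\<chi> i. if i = i0 then - \<lfloor>offset k\<rfloor> else k i)"
    have res: "?g n = k"
      using k by (auto simp: n_def fun_eq_iff PiE_def extensional_def)
    then have "offset (($) n) = offset k"
      by (metis offset_restrict)
    moreover have "\<bar>- of_int \<lfloor>offset k\<rfloor> + offset k\<bar> \<le> 1"
      by linarith
    ultimately have "\<bar>freq1 \<omega> n\<bar> \<le> 1 * 1"
      using \<omega>[of i0] unfolding freq1_offset abs_mult by (intro mult_mono) (auto simp: n_def)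
    moreover have "\<bar>n $ i\<bar> \<le> int R" if "i \<noteq> i0" for i
    proof -
      have "k i \<in> {- int R..int R}" using k that by blast
      with that show ?thesis by (simp add: n_def abs_le_iff)
    qed
    ultimately have "n \<in> slab \<omega> i0 R 1"
      by (simp add: slab_def)
    with res show "k \<in> ?g ` slab \<omega> i0 R 1" by blast
  qed
  then have "card (off_axis i0 R) \<le> card (slab \<omega> i0 R 1)"
    using surj_card_le[OF card_slab_le(1)] by blast
  then show ?thesis by (simp add: card_off_axis)
qed

end

section \<open>Clusters in dimensions one and two\<close>

lemma slab_closed:
  assumes "k \<in> slab \<omega> i0 R h" "l \<in> slab \<omega> i0 R h" "m \<in> slab \<omega> i0 R h"
  shows "k - l + m \<in> slab \<omega> i0 (3 * R) (3 * h)"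
proof -
  have "\<bar>(k - l + m) $ i\<bar> \<le> int (3 * R)" if "i \<noteq> i0" for i
  proof -
    have "\<bar>k $ i\<bar> \<le> int R" "\<bar>l $ i\<bar> \<le> int R" "\<bar>m $ i\<bar> \<le> int R"
      using assms that by (simp_all add: slab_def)
    then show ?thesis by simp
  qed
  moreover have "\<bar>freq1 \<omega> (k - l + m)\<bar> \<le> 3 * h"
  proof -
    have "\<bar>freq1 \<omega> k\<bar> \<le> h" "\<bar>freq1 \<omega> l\<bar> \<le> h" "\<bar>freq1 \<omega> m\<bar> \<le> h"
      using assms by (simp_all add: slab_def)
    then show ?thesis
      unfolding additive.add[OF additive_freq1] additive.diff[OF additive_freq1] by linarith
  qed
  ultimately show ?thesis by (simp add: slab_def)
qed

lemma clustering_freq1: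
  fixes \<omega> :: "real ^ 'n"
  assumes \<omega>: "\<And>i. \<omega> $ i \<in> {1/2<..1}"
  shows "clustering (freq1 \<omega>) size1 (CARD('n) - 1)"
proof -
  define \<nu> where "\<nu> = CARD('n)"
  \<comment> \<open>The first summand compares cardinalities, with \<open>14 = 2 * 6 + 2\<close>
    coming from \<open>card_slab_le\<close> at \<open>h = 3\<close>, and it also exceeds the
    frequency bound 3. The second bounds the sizes.\<close>
  define C :: real where "C = 14 * 3 ^ (\<nu> - 1) + 14 * real \<nu> ^ 2"
  have \<nu>: "1 \<le> \<nu>" by (simp add: \<nu>_def Suc_le_eq)
  have "\<exists>S0 S v. cluster (freq1 \<omega>) size1 (\<nu> - 1) C N S0 S v" if N: "1 \<le> N" for N
  proof -
    obtain i0 :: 'n where True by blast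
    \<comment> \<open>Coordinates on \<open>?S\<close> are at most \<open>6 * \<nu> * N\<close> in
      modulus, so this shift keeps the coordinate at \<open>i0\<close> above
      \<open>\<nu> * N\<close>, hence at least \<open>N\<close>.\<close>
    define v :: "int ^ 'n" where "v = axis i0 (int (7 * \<nu> * N))"
    let ?U = "slab \<omega> i0 N 1" and ?S = "slab \<omega> i0 (3 * N) 3"
    have "cluster (freq1 \<omega>) size1 (\<nu> - 1) C N ?U ?S v"
      unfolding cluster_def
    proof (intro conjI ballI)
      show "finite ?S" by (rule card_slab_le(1)[OF \<omega>])
      show "?U \<subseteq> ?S" by (force simp: slab_def)
      show "k - l + m \<in> ?S" if "k \<in> ?U" "l \<in> ?U" "m \<in> ?U" for k l m
        using slab_closed[OF that] by simp
      have "real N ^ (\<nu> - 1) \<le> real (2 * N + 1) ^ (\<nu> - 1)"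
        by (intro power_mono) auto
      also have "\<dots> \<le> real (card ?U)"
        using card_slab_ge[OF \<omega>, of N i0] unfolding \<nu>_def of_nat_power[symmetric] of_nat_le_iff .
      finally show "real N ^ (\<nu> - 1) \<le> real (card ?U)" .
      have "card ?S \<le> (2 * (3 * N) + 1) ^ (\<nu> - 1) * 14"
        using card_slab_le(2)[OF \<omega>, of i0 "3 * N" 3] by (simp add: \<nu>_def)
      \<comment> \<open>Tripling the base makes the upper count comparable to the lower count for
        \<open>?U\<close>, at the cost of \<open>3 ^ (\<nu> - 1)\<close>.\<close>
      also have "\<dots> \<le> (3 * (2 * N + 1)) ^ (\<nu> - 1) * 14"
        by (intro mult_right_mono power_mono) auto
      also have "\<dots> = 14 * 3 ^ (\<nu> - 1) * (2 * N + 1) ^ (\<nu> - 1)"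
        unfolding power_mult_distrib by simp
      also have "\<dots> \<le> 14 * 3 ^ (\<nu> - 1) * card ?U"
        using card_slab_ge[OF \<omega>, of N i0] unfolding \<nu>_def by (rule mult_left_mono) simp
      finally have "real (card ?S) \<le> real (14 * 3 ^ (\<nu> - 1) * card ?U)"
        by (simp only: of_nat_le_iff)
      also have "\<dots> = 14 * 3 ^ (\<nu> - 1) * real (card ?U)"
        by simp
      also have "\<dots> \<le> C * real (card ?U)"
        by (intro mult_right_mono) (auto simp: C_def)
      finally show "real (card ?S) \<le> C * real (card ?U)" .
    next
      fix n assume n: "n \<in> ?S"
      have "(3::real) \<le> 14 * 3 ^ (\<nu> - 1)"
        using one_le_power[of "3::real" "\<nu> - 1"] by linarith
      then have "3 \<le> C"
        using zero_le_power2[of "real \<nu>"] unfolding C_def by linarith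
      then show "norm (freq1 \<omega> n) \<le> C"
        using n by (simp add: slab_def)
      have box: "\<bar>n $ i\<bar> \<le> int (6 * \<nu> * N)" for i
        using slab_subset_box[OF \<omega>, of "3 * N" 3 n i0 i] N n by (simp add: \<nu>_def mult.assoc)
      have "real N \<le> real_of_int (int (7 * \<nu> * N) + n $ i0)"
      proof -
        have "int N * 1 \<le> int N * int \<nu>"
          using \<nu> by (intro mult_left_mono) auto
        then have "int N \<le> int (7 * \<nu> * N) + n $ i0"
          using box[of i0] by (simp add: abs_le_iff algebra_simps)
        then have "real_of_int (int N) \<le> real_of_int (int (7 * \<nu> * N) + n $ i0)"
          by (simp only: of_int_le_iff)
        then show ?thesis by simp
      qed
      also have "\<dots> = int_vec (v + n) $ i0"
        by (simp add: int_vec_def v_def axis_def)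
      also have "\<dots> \<le> norm (int_vec (v + n))"
        using component_le_norm_cart[of "int_vec (v + n)" i0] by linarith
      finally show "real N \<le> 1 + size1 (v + n)"
        by (simp add: size1_def)
      \<comment> \<open>The norm is bounded by the sum of \<open>\<nu>\<close> coordinates of
        modulus at most \<open>(7 + 6) * \<nu> * N\<close>.\<close>
      have "norm (int_vec (v + n)) \<le> (\<Sum>i\<in>UNIV. \<bar>int_vec (v + n) $ i\<bar>)"
        by (rule norm_le_l1_cart)
      also have "\<dots> \<le> (\<Sum>i\<in>(UNIV :: 'n set). real (13 * \<nu> * N))"
      proof (rule sum_mono)
        fix i
        have "\<bar>v $ i\<bar> \<le> int (7 * \<nu> * N)"
          by (simp add: v_def axis_def)
        then have "\<bar>(v + n) $ i\<bar> \<le> int (13 * \<nu> * N)"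
          using box[of i] by (simp add: algebra_simps)
        then have "real_of_int \<bar>(v + n) $ i\<bar> \<le> real_of_int (int (13 * \<nu> * N))"
          by (simp only: of_int_le_iff)
        then show "\<bar>int_vec (v + n) $ i\<bar> \<le> real (13 * \<nu> * N)"
          by (simp add: int_vec_def)
      qed
      also have "\<dots> = 13 * real \<nu> ^ 2 * real N"
        by (simp add: \<nu>_def power2_eq_square)
      finally have "1 + size1 (v + n) \<le> real N + 13 * real \<nu> ^ 2 * real N"
        using N by (simp add: size1_def)
      also have "\<dots> \<le> C * real N"
      proof -
        have "1 \<le> real \<nu> ^ 2" using \<nu> by simp
        then have "1 + 13 * real \<nu> ^ 2 \<le> C"
          unfolding C_def using zero_le_power[of "3::real" "\<nu> - 1"] by linarith
        then have "(1 + 13 * real \<nu> ^ 2) * real N \<le> C * real N"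
          by (rule mult_right_mono) simp
        then show ?thesis by (simp add: algebra_simps)
      qed
      finally show "1 + size1 (v + n) \<le> C * real N" .
    qed
    then show ?thesis by blast
  qed
  then show ?thesis
    unfolding clustering_def \<nu>_def by blast
qed

text \<open>The cardinality bound makes \<open>S0\<close> nonempty, and at any of its points the
  size lies between the two bounds. This allows constants to be compared when clusters are
  multiplied.\<close>

lemma cluster_imp_ge_1:
  assumes "cluster \<phi> sz b C N S0 S v" "1 \<le> N"
  shows "1 \<le> C"
proof -
  have "0 < real N ^ b" using assms(2) by simp
  also have "\<dots> \<le> real (card S0)"
    using assms(1) by (simp add: cluster_def)
  finally obtain m where "m \<in> S0" by (auto simp: card_gt_0_iff)
  then have "m \<in> S" using assms(1) by (auto simp: cluster_def)
  then have "real N \<le> 1 + sz (v + m)" "1 + sz (v + m) \<le> C * real N"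
    using assms(1) by (simp_all add: cluster_def)
  then have "1 * real N \<le> C * real N" by linarith
  then show ?thesis using assms(2) by simp
qed

text \<open>Cardinalities multiply, so the exponents add. Frequencies and sizes of pairs are
  controlled by \<open>C1 + C2\<close>, cardinalities by \<open>C1 * C2\<close>. The lower bound on
  the size is inherited from the first factor.\<close>

lemma cluster_freq2:
  assumes c1: "cluster (freq1 \<omega>1) size1 b1 C1 N S0 S v"
    and c2: "cluster (freq1 \<omega>2) size1 b2 C2 N S0' S' v'" and "1 \<le> N"
  shows "cluster (freq2 \<omega>1 \<omega>2) size2 (b1 + b2) (C1 + C2 + C1 * C2) N (S0 \<times> S0') (S \<times> S') (v, v')"
  unfolding cluster_def
proof (intro conjI ballI)
  let ?C = "C1 + C2 + C1 * C2"
  have C: "1 \<le> C1" "1 \<le> C2"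
    using cluster_imp_ge_1[OF c1 \<open>1 \<le> N\<close>] cluster_imp_ge_1[OF c2 \<open>1 \<le> N\<close>] .
  then have C12: "C1 + C2 \<le> ?C" "C1 * C2 \<le> ?C" by simp_all
  show "finite (S \<times> S')" "S0 \<times> S0' \<subseteq> S \<times> S'"
    using c1 c2 by (auto simp: cluster_def)
  show "k - l + m \<in> S \<times> S'" if "k \<in> S0 \<times> S0'" "l \<in> S0 \<times> S0'" "m \<in> S0 \<times> S0'" for k l m
    using that c1 c2 by (auto simp: cluster_def)
  have "real N ^ (b1 + b2) \<le> real (card S0) * real (card S0')"
    unfolding power_add using c1 c2 by (intro mult_mono) (auto simp: cluster_def)
  then show "real N ^ (b1 + b2) \<le> real (card (S0 \<times> S0'))"
    by (simp add: card_cartesian_product)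
  have "real (card S) * real (card S') \<le> (C1 * real (card S0)) * (C2 * real (card S0'))"
    using c1 c2 C by (intro mult_mono) (auto simp: cluster_def)
  also have "\<dots> = C1 * C2 * real (card (S0 \<times> S0'))"
    by (simp add: card_cartesian_product)
  also have "\<dots> \<le> ?C * real (card (S0 \<times> S0'))"
    using C12(2) by (rule mult_right_mono) simp
  finally show "real (card (S \<times> S')) \<le> ?C * real (card (S0 \<times> S0'))"
    by (simp add: card_cartesian_product)
  fix p assume "p \<in> S \<times> S'"
  then obtain n n' where p: "p = (n, n')" "n \<in> S" "n' \<in> S'" by auto
  have "norm (freq1 \<omega>1 n) \<le> C1" "norm (freq1 \<omega>2 n') \<le> C2"
    using c1 c2 p by (simp_all add: cluster_def del: real_norm_def)
  then show "norm (freq2 \<omega>1 \<omega>2 p) \<le> ?C"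
    using norm_Pair_le[of "freq1 \<omega>1 n" "freq1 \<omega>2 n'"] C12(1) unfolding p(1) freq2_eq fst_conv snd_conv
    by linarith
  have sz: "real N \<le> 1 + size1 (v + n)" "1 + size1 (v + n) \<le> C1 * real N" "1 + size1 (v' + n') \<le> C2 * real N"
    using c1 c2 p by (simp_all add: cluster_def)
  have sz2: "size2 ((v, v') + p) = norm (int_vec (v + n), int_vec (v' + n'))"
    by (simp add: p(1) size2_def)
  show "real N \<le> 1 + size2 ((v, v') + p)"
    using sz(1) norm_fst_le[of "int_vec (v + n)" "int_vec (v' + n')"] unfolding sz2 size1_def by linarith
  have "1 + size2 ((v, v') + p) \<le> C1 * real N + C2 * real N"
    using sz(2,3) norm_Pair_le[of "int_vec (v + n)" "int_vec (v' + n')"] unfolding sz2 size1_def by linarith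
  also have "\<dots> = (C1 + C2) * real N" by (simp add: distrib_right)
  also have "\<dots> \<le> ?C * real N" using C12(1) by (rule mult_right_mono) simp
  finally show "1 + size2 ((v, v') + p) \<le> ?C * real N" .
qed

lemma clustering_freq2:
  fixes \<omega>1 :: "real ^ 'n1" and \<omega>2 :: "real ^ 'n2"
  assumes "\<And>i. \<omega>1 $ i \<in> {1/2<..1}" "\<And>i. \<omega>2 $ i \<in> {1/2<..1}"
  shows "clustering (freq2 \<omega>1 \<omega>2) size2 ((CARD('n1) - 1) + (CARD('n2) - 1))"
proof -
  obtain C1 where C1: "\<And>N. 1 \<le> N \<Longrightarrow> \<exists>S0 S v. cluster (freq1 \<omega>1) size1 (CARD('n1) - 1) C1 N S0 S v"
    using clustering_freq1[OF assms(1)] unfolding clustering_def by blast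
  obtain C2 where C2: "\<And>N. 1 \<le> N \<Longrightarrow> \<exists>S0 S v. cluster (freq1 \<omega>2) size1 (CARD('n2) - 1) C2 N S0 S v"
    using clustering_freq1[OF assms(2)] unfolding clustering_def by blast
  have "\<exists>S0 S v. cluster (freq2 \<omega>1 \<omega>2) size2
      ((CARD('n1) - 1) + (CARD('n2) - 1)) (C1 + C2 + C1 * C2) N S0 S v" if "1 \<le> N" for N
    using C1[OF that] C2[OF that] cluster_freq2[OF _ _ that] by blast
  then show ?thesis
    unfolding clustering_def by blast
qed

theorem proposition6p2:
  fixes \<omega> :: "real ^ 'n" and \<omega>1 :: "real ^ 'n1" and \<omega>2 :: "real ^ 'n2"
    and s T :: real
  assumes "T > 0"
  shows "(non_resonant \<omega> \<and> (\<forall>i. \<omega> $ i \<in> {1/2<..1}) \<and>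
           s < (real CARD('n) - 1) / 2 \<longrightarrow>
           \<not> (\<exists>K :: real. \<forall>f \<in> trig_polys (freq1 \<omega>).
                (SUP t\<in>{0..T}. ereal (sobolev_norm (freq1 \<omega>) size1 s (picard (freq1 \<omega>) t f)))
                \<le> ereal (K * sobolev_norm (freq1 \<omega>) size1 s f ^ 3)))
       \<and> (non_resonant \<omega>1 \<and> non_resonant \<omega>2 \<and>
           (\<forall>i. \<omega>1 $ i \<in> {1/2<..1}) \<and> (\<forall>i. \<omega>2 $ i \<in> {1/2<..1}) \<and>
           s < ((real CARD('n1) - 1) + (real CARD('n2) - 1)) / 2 \<longrightarrow>
           \<not> (\<exists>K :: real. \<forall>f \<in> trig_polys (freq2 \<omega>1 \<omega>2).
                (SUP t\<in>{0..T}. ereal (sobolev_norm (freq2 \<omega>1 \<omega>2) size2 s (picard (freq2 \<omega>1 \<omega>2) t f)))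
                \<le> ereal (K * sobolev_norm (freq2 \<omega>1 \<omega>2) size2 s f ^ 3)))"
proof (intro conjI impI; elim conjE)
  assume \<omega>: "non_resonant \<omega>" "\<forall>i. \<omega> $ i \<in> {1/2<..1}"
    and "s < (real CARD('n) - 1) / 2"
  \<comment> \<open>Index types are nonempty, so subtraction on natural numbers agrees here with the
    real one.\<close>
  then have s: "s < real (CARD('n) - 1) / 2"
    by (simp add: of_nat_diff Suc_le_eq)
  show "\<not> (\<exists>K :: real. \<forall>f \<in> trig_polys (freq1 \<omega>).
                (SUP t\<in>{0..T}. ereal (sobolev_norm (freq1 \<omega>) size1 s (picard (freq1 \<omega>) t f)))
                \<le> ereal (K * sobolev_norm (freq1 \<omega>) size1 s f ^ 3))"
    by (rule clustering_imp_unbounded[OF additive_freq1 inj_freq1[OF \<omega>(1)]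
          clustering_freq1[OF \<omega>(2)[rule_format]] s assms])
next
  assume \<omega>: "non_resonant \<omega>1" "non_resonant \<omega>2"
      "\<forall>i. \<omega>1 $ i \<in> {1/2<..1}" "\<forall>i. \<omega>2 $ i \<in> {1/2<..1}"
    and "s < ((real CARD('n1) - 1) + (real CARD('n2) - 1)) / 2"
  then have s: "s < real ((CARD('n1) - 1) + (CARD('n2) - 1)) / 2"
    by (simp add: of_nat_diff Suc_le_eq)
  show "\<not> (\<exists>K :: real. \<forall>f \<in> trig_polys (freq2 \<omega>1 \<omega>2).
                (SUP t\<in>{0..T}. ereal (sobolev_norm (freq2 \<omega>1 \<omega>2) size2 s (picard (freq2 \<omega>1 \<omega>2) t f)))
                \<le> ereal (K * sobolev_norm (freq2 \<omega>1 \<omega>2) size2 s f ^ 3))"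
    by (rule clustering_imp_unbounded[OF additive_freq2 inj_freq2[OF \<omega>(1,2)]
          clustering_freq2[OF \<omega>(3)[rule_format] \<omega>(4)[rule_format]] s assms])
qed

end
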